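(* Let $\mathbb{K}$ be a field and let $q\in\mathbb{K}$ be nonzero with $q^2\neq1$. For each $i\in\mathbb{Z}_4$ there exists a homomorphism of $\mathbb{K}$-algebras from $\mathcal{A}_q$ to $\boxtimes_q$ that sends the standard generators $x,y$ to $x_{i,i+1},x_{i+2,i+3}$ respectively.
   Context: Let $[n]_q=\frac{q^n-q^{-n}}{q-q^{-1}}$ and $\mathbb{Z}_4=\mathbb{Z}/4\mathbb{Z}$. The $q$-tetrahedron algebra $\boxtimes_q$ is the unital associative $\mathbb{K}$-algebra with generators $\{x_{ij}\mid i,j\in\mathbb{Z}_4,\ j-i=1\text{ or }j-i=2\}$ and relations: (i) for $i,j\in\mathbb{Z}_4$ with $j-i=2$, $x_{ij}x_{ji}=1$; (ii) for $h,i,j\in\mathbb{Z}_4$ such that $(i-h,j-i)$ is one of $(1,1),(1,2),(2,1)$, $\frac{q x_{hi}x_{ij}-q^{-1}x_{ij}x_{hi}}{q-q^{-1}}=1$; (iii) for $h,i,j,k\in\mathbb{Z}_4$ with $i-h=j-i=k-j=1$, $x_{hi}^3x_{jk}-[3]_q x_{hi}^2x_{jk}x_{hi}+[3]_q x_{hi}x_{jk}x_{hi}^2-x_{jk}x_{hi}^3=0$. $\mathcal{A}_q$ (the positive part of $U_q(\widehat{\mathfrak{sl}}_2)$) is the unital associative $\mathbb{K}$-algebra with generators $x,y$ (the standard generators) and relations $x^3y-[3]_q x^2yx+[3]_q xyx^2-yx^3=0$ and $y^3x-[3]_q y^2xy+[3]_q yxy^2-xy^3=0$. *)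

theory Defs
  imports
    "HOL-Algebra.QuotRing"
    "HOL-Algebra.Module"
    "HOL-Library.Poly_Mapping"
    "HOL-Library.Numeral_Type"
begin

text \<open>
  Words form the free monoid. It is written additively because the convolution product on
  \<^typ>\<open>'a \<Rightarrow>\<^sub>0 'b\<close> requires an additive (not necessarily commutative) monoid of exponents.
\<close>

datatype 'g word = Word (letters: "'g list")

instantiation word :: (type) monoid_add
begin

definition zero_word :: "'a word"
  where "0 = Word []"

definition plus_word :: "'a word \<Rightarrow> 'a word \<Rightarrow> 'a word"
  where "u + v = Word (letters u @ letters v)"

instance
  by standard (simp_all add: zero_word_def plus_word_def)

end

lemma letters_zero [simp]: "letters 0 = []"
  by (simp add: zero_word_def)

lemma letters_plus [simp]: "letters (u + v) = letters u @ letters v"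
  by (simp add: plus_word_def)

text \<open>Noncommutative polynomials over \<open>'k\<close> in the letters \<open>'g\<close>.\<close>

type_synonym ('g, 'k) ncpoly = "'g word \<Rightarrow>\<^sub>0 'k"

definition scalar :: "'k::field \<Rightarrow> ('g, 'k) ncpoly"
  where "scalar c = Poly_Mapping.single 0 c"

definition letter :: "'g \<Rightarrow> ('g, 'k::field) ncpoly"
  where "letter g = Poly_Mapping.single (Word [g]) 1"

definition free_algebra :: "'g set \<Rightarrow> ('k::field, ('g, 'k) ncpoly) module"
  where "free_algebra G =
    \<lparr>carrier = {p. \<forall>w \<in> Poly_Mapping.keys p. set (letters w) \<subseteq> G},
     monoid.mult = (*), one = 1, zero = 0, add = (+),
     smult = (\<lambda>c p. scalar c * p)\<rparr>"

lemma free_algebra_ring: "ring (free_algebra G :: ('k::field, ('g, 'k) ncpoly) module)"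
proof -
  let ?F = "free_algebra G :: ('k, ('g, 'k) ncpoly) module"
  have add: "p + r \<in> carrier ?F" if "p \<in> carrier ?F" "r \<in> carrier ?F" for p r
    using that keys_add[of p r] unfolding free_algebra_def by fastforce
  have mult: "p * r \<in> carrier ?F" if "p \<in> carrier ?F" "r \<in> carrier ?F" for p r
    using that keys_mult[of p r] unfolding free_algebra_def by fastforce
  have neg: "- p \<in> carrier ?F" if "p \<in> carrier ?F" for p
    using that unfolding free_algebra_def by simp
  have ops: "monoid.mult ?F = (*)" "one ?F = 1" "zero ?F = 0" "add ?F = (+)"
    by (simp_all add: free_algebra_def)
  have zero: "0 \<in> carrier ?F" and one: "1 \<in> carrier ?F"
    by (simp_all add: free_algebra_def)
  show ?thesis
  proof (rule ringI)
    show "abelian_group ?F"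
    proof (rule abelian_groupI; unfold ops)
      show "\<exists>y\<in>carrier ?F. y + x = 0" if "x \<in> carrier ?F" for x
        using neg[OF that] by (intro bexI[of _ "- x"]) simp_all
    qed (simp_all add: add zero add.assoc add.commute)
    show "Group.monoid ?F"
      by (rule monoidI; unfold ops) (simp_all add: mult one mult.assoc)
  qed (simp_all add: ops distrib_left distrib_right)
qed

lemma scalar_in_free_algebra: "scalar c \<in> carrier (free_algebra G)"
  by (simp add: free_algebra_def scalar_def)

lemma letter_in_free_algebra: "g \<in> G \<Longrightarrow> letter g \<in> carrier (free_algebra G)"
  by (simp add: free_algebra_def letter_def)


text \<open>
  The quotient of the free algebra on \<open>G\<close> by the two-sided ideal generated by \<open>Rel\<close>
  (an element \<open>p\<close> of \<open>Rel\<close> stands for the relation \<open>p = 0\<close>). The scalar multiplication is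
  the one induced on cosets, in the style of \<^const>\<open>rcoset_mult\<close>.
\<close>

definition relation_ideal :: "'g set \<Rightarrow> ('g, 'k::field) ncpoly set \<Rightarrow> ('g, 'k) ncpoly set"
  where "relation_ideal G Rel = genideal (free_algebra G) Rel"

definition presented_algebra ::
    "'g set \<Rightarrow> ('g, 'k::field) ncpoly set \<Rightarrow> ('k, ('g, 'k) ncpoly set) module"
  where "presented_algebra G Rel =
    (let F = free_algebra G; I = relation_ideal G Rel in
     ring.extend (F Quot I)
       (module.fields (\<lambda>c A. \<Union>a\<in>A. I +>\<^bsub>F\<^esub> (c \<odot>\<^bsub>F\<^esub> a))))"

definition presented_gen :: "'g set \<Rightarrow> ('g, 'k::field) ncpoly set \<Rightarrow> 'g \<Rightarrow> ('g, 'k) ncpoly set"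
  where "presented_gen G Rel g = relation_ideal G Rel +>\<^bsub>free_algebra G\<^esub> letter g"

lemma presented_algebra_ring:
  assumes "Rel \<subseteq> carrier (free_algebra G)"
  shows "ring (presented_algebra G Rel)"
proof -
  interpret F: ring "free_algebra G" by (rule free_algebra_ring)
  interpret I: ideal "relation_ideal G Rel" "free_algebra G"
    unfolding relation_ideal_def using assms by (rule F.genideal_ideal)
  interpret Q: ring "free_algebra G Quot relation_ideal G Rel"
    by (rule I.quotient_is_ring)
  let ?P = "presented_algebra G Rel" and ?Q = "free_algebra G Quot relation_ideal G Rel"
  have eqs: "carrier ?P = carrier ?Q" "monoid.mult ?P = monoid.mult ?Q" "one ?P = one ?Q"
    "zero ?P = zero ?Q" "add ?P = add ?Q"
    by (simp_all add: presented_algebra_def Let_def ring.defs)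
  show ?thesis
  proof (rule ringI; (unfold eqs)?)
    show "abelian_group ?P"
    proof (rule abelian_groupI; unfold eqs)
      show "\<exists>y\<in>carrier ?Q. y \<oplus>\<^bsub>?Q\<^esub> x = \<zero>\<^bsub>?Q\<^esub>" if "x \<in> carrier ?Q" for x
        using Q.l_neg[OF that] Q.a_inv_closed[OF that] by (rule bexI)
    qed (rule Q.a_closed Q.zero_closed Q.a_assoc Q.a_comm Q.l_zero; assumption)+
    show "Group.monoid ?P"
      by (rule monoidI; unfold eqs)
        (rule Q.m_closed Q.one_closed Q.m_assoc Q.l_one Q.r_one; assumption)+
  qed (rule Q.l_distr Q.r_distr; assumption)+
qed

lemma presented_algebra_smult:
  assumes "Rel \<subseteq> carrier (free_algebra G)" "p \<in> carrier (free_algebra G)"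
  shows "c \<odot>\<^bsub>presented_algebra G Rel\<^esub> (relation_ideal G Rel +>\<^bsub>free_algebra G\<^esub> p)
    = relation_ideal G Rel +>\<^bsub>free_algebra G\<^esub> (c \<odot>\<^bsub>free_algebra G\<^esub> p)"
proof -
  let ?F = "free_algebra G" and ?I = "relation_ideal G Rel"
  interpret F: ring ?F by (rule free_algebra_ring)
  interpret I: ideal ?I ?F
    unfolding relation_ideal_def using assms(1) by (rule F.genideal_ideal)
  have sm: "c \<odot>\<^bsub>?F\<^esub> a = scalar c \<otimes>\<^bsub>?F\<^esub> a" for a
    by (simp add: free_algebra_def)
  have sc: "scalar c \<in> carrier ?F" by (rule scalar_in_free_algebra)
  have "?I +>\<^bsub>?F\<^esub> (c \<odot>\<^bsub>?F\<^esub> a) = ?I +>\<^bsub>?F\<^esub> (c \<odot>\<^bsub>?F\<^esub> p)" if "a \<in> ?I +>\<^bsub>?F\<^esub> p" for a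
  proof -
    have a: "a \<in> carrier ?F" using that assms(2) F.a_r_coset_subset_G[OF I.a_subset] by blast
    have "?I +>\<^bsub>?F\<^esub> a = ?I +>\<^bsub>?F\<^esub> p"
      using F.a_repr_independence[OF that assms(2)] I.a_subgroup by simp
    moreover have "?I +>\<^bsub>?F\<^esub> (scalar c \<otimes>\<^bsub>?F\<^esub> b) = [mod ?I:] (?I +>\<^bsub>?F\<^esub> scalar c) \<Otimes>\<^bsub>?F\<^esub> (?I +>\<^bsub>?F\<^esub> b)"
      if "b \<in> carrier ?F" for b
      using I.rcoset_mult_add[OF sc that] by simp
    ultimately show ?thesis using a assms(2) by (simp add: sm)
  qed
  moreover have "p \<in> ?I +>\<^bsub>?F\<^esub> p" using I.a_rcos_self assms(2) by blast
  ultimately have "(\<Union>a \<in> ?I +>\<^bsub>?F\<^esub> p. ?I +>\<^bsub>?F\<^esub> (c \<odot>\<^bsub>?F\<^esub> a)) = ?I +>\<^bsub>?F\<^esub> (c \<odot>\<^bsub>?F\<^esub> p)"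
    by blast
  then show ?thesis
    by (simp add: presented_algebra_def Let_def ring.defs module.defs)
qed

text \<open>Homomorphisms of unital algebras; \<^const>\<open>ring_hom\<close> already includes preservation of the unit.\<close>

definition alg_hom ::
    "('k, 'a, 'm) module_scheme \<Rightarrow> ('k, 'b, 'n) module_scheme \<Rightarrow> ('a \<Rightarrow> 'b) set"
  where "alg_hom A B =
    {\<phi> \<in> ring_hom A B. \<forall>c. \<forall>a \<in> carrier A. \<phi> (c \<odot>\<^bsub>A\<^esub> a) = c \<odot>\<^bsub>B\<^esub> \<phi> a}"


definition qint :: "'k::field \<Rightarrow> nat \<Rightarrow> 'k"
  where "qint q n = (q ^ n - inverse q ^ n) / (q - inverse q)"

definition q_serre :: "'k::field \<Rightarrow> ('g, 'k) ncpoly \<Rightarrow> ('g, 'k) ncpoly \<Rightarrow> ('g, 'k) ncpoly"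
  where "q_serre q x y =
    x^3 * y - scalar (qint q 3) * x^2 * y * x + scalar (qint q 3) * x * y * x^2 - y * x^3"

datatype Aq_letter = LX | LY

definition Aq_rels :: "'k::field \<Rightarrow> (Aq_letter, 'k) ncpoly set"
  where "Aq_rels q = {q_serre q (letter LX) (letter LY), q_serre q (letter LY) (letter LX)}"

definition Aq :: "'k::field \<Rightarrow> ('k, (Aq_letter, 'k) ncpoly set) module"
  where "Aq q = presented_algebra UNIV (Aq_rels q)"

definition Aq_x :: "'k::field \<Rightarrow> (Aq_letter, 'k) ncpoly set"
  where "Aq_x q = presented_gen UNIV (Aq_rels q) LX"

definition Aq_y :: "'k::field \<Rightarrow> (Aq_letter, 'k) ncpoly set"
  where "Aq_y q = presented_gen UNIV (Aq_rels q) LY"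

text \<open>
  The type \<open>4\<close> of \<open>HOL-Library.Numeral_Type\<close> is the ring of integers modulo 4;
  the letter \<open>(i, j)\<close> stands for \<open>x\<^sub>i\<^sub>j\<close>.
\<close>

definition tet_letters :: "(4 \<times> 4) set"
  where "tet_letters = {(i, j). j - i = 1 \<or> j - i = 2}"

definition tet_rels :: "'k::field \<Rightarrow> (4 \<times> 4, 'k) ncpoly set"
  where "tet_rels q =
    {letter (i, j) * letter (j, i) - 1 | i j. j - i = 2}
    \<union> {scalar (1 / (q - inverse q)) *
          (scalar q * letter (h, i) * letter (i, j)
           - scalar (inverse q) * letter (i, j) * letter (h, i)) - 1
        | h i j. (i - h, j - i) \<in> {(1, 1), (1, 2), (2, 1)}}
    \<union> {q_serre q (letter (h, i)) (letter (j, k)) | h i j k. i - h = 1 \<and> j - i = 1 \<and> k - j = 1}"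

definition tet :: "'k::field \<Rightarrow> ('k, (4 \<times> 4, 'k) ncpoly set) module"
  where "tet q = presented_algebra tet_letters (tet_rels q)"

text \<open>Only meaningful when \<open>j - i\<close> is 1 or 2.\<close>

definition tet_x :: "'k::field \<Rightarrow> 4 \<Rightarrow> 4 \<Rightarrow> (4 \<times> 4, 'k) ncpoly set"
  where "tet_x q i j = presented_gen tet_letters (tet_rels q) (i, j)"

lemma Aq_rels_subset: "Aq_rels q \<subseteq> carrier (free_algebra UNIV)"
  by (auto simp: free_algebra_def)

lemma tet_rels_subset: "tet_rels q \<subseteq> carrier (free_algebra tet_letters)"
proof -
  let ?C = "carrier (free_algebra tet_letters) :: (4 \<times> 4, 'a) ncpoly set"
  have mult: "p * r \<in> ?C" if "p \<in> ?C" "r \<in> ?C" for p r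
    using that keys_mult[of p r] unfolding free_algebra_def by fastforce
  have add: "p + r \<in> ?C" if "p \<in> ?C" "r \<in> ?C" for p r
    using that keys_add[of p r] unfolding free_algebra_def by fastforce
  have diff: "p - r \<in> ?C" if "p \<in> ?C" "r \<in> ?C" for p r
    using that keys_diff[of p r] unfolding free_algebra_def by fastforce
  have one: "1 \<in> ?C" by (simp add: free_algebra_def)
  have pow: "p ^ n \<in> ?C" if "p \<in> ?C" for p n
    by (induction n) (use that one mult in auto)
  have serre: "q_serre q p r \<in> ?C" if "p \<in> ?C" "r \<in> ?C" for p r
    unfolding q_serre_def
    by (intro add diff mult pow that scalar_in_free_algebra)
  have let2: "letter (i, j) \<in> ?C" if "j - i = 1 \<or> j - i = 2" for i j
    by (rule letter_in_free_algebra) (use that in \<open>simp add: tet_letters_def\<close>)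
  have inv2: "i - j = 2" if "j - i = 2" for i j :: 4
  proof -
    have "i - j = - (j - i)" by simp
    also have "\<dots> = 2" using that by simp
    finally show ?thesis .
  qed
  have gen2: "letter (h, i) \<in> ?C \<and> letter (i, j) \<in> ?C"
    if "(i - h, j - i) \<in> {(1, 1), (1, 2), (2, 1)}" for h i j
    using that let2 by blast
  show ?thesis
    unfolding tet_rels_def
  proof (intro Un_least subsetI; elim CollectE exE conjE; hypsubst)
    fix i j :: 4 assume "j - i = 2"
    with inv2[OF this] show "letter (i, j) * letter (j, i) - 1 \<in> ?C"
      by (intro diff mult one let2 disjI2)
  next
    fix h i j :: 4 assume "(i - h, j - i) \<in> {(1, 1), (1, 2), (2, 1)}"
    note gen2[OF this, THEN conjunct1] gen2[OF this, THEN conjunct2]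
    then show "scalar (1 / (q - inverse q)) *
          (scalar q * letter (h, i) * letter (i, j)
           - scalar (inverse q) * letter (i, j) * letter (h, i)) - 1 \<in> ?C"
      by (intro diff mult one scalar_in_free_algebra)
  next
    fix h i j k :: 4 assume "i - h = 1" "k - j = 1"
    then show "q_serre q (letter (h, i)) (letter (j, k)) \<in> ?C"
      by (intro serre let2 disjI1)
  qed
qed

lemma Aq_ring: "ring (Aq q)"
  unfolding Aq_def by (rule presented_algebra_ring[OF Aq_rels_subset])

lemma tet_ring: "ring (tet q)"
  unfolding tet_def by (rule presented_algebra_ring[OF tet_rels_subset])

end

theory Submission
  imports Defs
begin

text \<open>
  The defining relations of \<^term>\<open>Aq q\<close> are two cubic \<open>q\<close>-Serre relations, one for each
  order of the two generators. In the tetrahedron algebra the cubic relation holds between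
  \<open>x\<^sub>a\<^sub>b\<close> and \<open>x\<^sub>c\<^sub>d\<close> whenever \<open>a, b, c, d\<close> are consecutive modulo 4. Starting at \<open>a = i\<close> this is
  the Serre relation for the pair \<open>x\<^sub>i\<^sub>,\<^sub>i\<^sub>+\<^sub>1, x\<^sub>i\<^sub>+\<^sub>2\<^sub>,\<^sub>i\<^sub>+\<^sub>3\<close>; starting at \<open>a = i + 2\<close> it is
  the Serre relation for the same pair in the opposite order, because \<open>i + 4 = i\<close>. So
  renaming the letters \<open>x, y\<close> takes defining relations to defining relations.

  Two facts turn this observation into a homomorphism. Renaming letters is a homomorphism
  of free algebras (\<open>rename_alg_hom\<close>), and a homomorphism from a free algebra that kills the
  relations descends to the presented algebra (\<open>presented_algebra_universal\<close>).
\<close>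

definition rename :: "('g \<Rightarrow> 'h) \<Rightarrow> ('g, 'k::field) ncpoly \<Rightarrow> ('h, 'k) ncpoly"
  where "rename f p =
    (\<Sum>w\<in>Poly_Mapping.keys p. Poly_Mapping.single (map_word f w) (Poly_Mapping.lookup p w))"

lemma map_word_zero: "map_word f 0 = 0"
  by (simp add: zero_word_def)

lemma map_word_plus: "map_word f (u + v) = map_word f u + map_word f v"
  by (simp add: plus_word_def word.map_sel)

text \<open>
  Sums over the supports of \<open>p\<close>, \<open>r\<close> and \<open>p + r\<close> are only comparable after extending them
  to one common index set; this makes additivity of \<^const>\<open>rename\<close> a termwise statement.
\<close>

lemma rename_superset:
  assumes "finite A" "Poly_Mapping.keys p \<subseteq> A"
  shows "rename f p =
    (\<Sum>w\<in>A. Poly_Mapping.single (map_word f w) (Poly_Mapping.lookup p w))"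
  unfolding rename_def using assms
  by (intro sum.mono_neutral_left) (auto simp: in_keys_iff)

lemma rename_single:
  "rename f (Poly_Mapping.single w c) = Poly_Mapping.single (map_word f w) c"
  by (subst rename_superset[of "{w}"]) auto

lemma rename_add: "rename f (p + r) = rename f p + rename f r"
proof -
  let ?A = "Poly_Mapping.keys p \<union> Poly_Mapping.keys r"
  show ?thesis
    using keys_add[of p r]
    by (simp add: rename_superset[of ?A] lookup_add single_add sum.distrib)
qed

lemma rename_zero: "rename f 0 = 0"
  by (simp add: rename_def)

lemma rename_diff: "rename f (p - r) = rename f p - rename f r"
  by (metis rename_add add_diff_cancel_right' diff_add_cancel)

lemma rename_sum: "rename f (\<Sum>a\<in>A. g a) = (\<Sum>a\<in>A. rename f (g a))"
  by (induction A rule: infinite_finite_induct) (simp_all add: rename_zero rename_add)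

lemma ncpoly_eq_sum_single:
  "p = (\<Sum>w\<in>Poly_Mapping.keys p. Poly_Mapping.single w (Poly_Mapping.lookup p w))"
  by (rule poly_mapping_eqI)
    (auto simp: lookup_sum lookup_single when_def in_keys_iff)

lemma rename_mult: "rename f (p * r) = rename f p * rename f r"
proof -
  let ?P = "Poly_Mapping.keys p" and ?R = "Poly_Mapping.keys r"
  let ?p = "Poly_Mapping.lookup p" and ?r = "Poly_Mapping.lookup r"
  have "p * r = (\<Sum>u\<in>?P. \<Sum>v\<in>?R. Poly_Mapping.single (u + v) (?p u * ?r v))"
    by (subst ncpoly_eq_sum_single[of p], subst ncpoly_eq_sum_single[of r])
      (simp only: sum_product mult_single)
  then have "rename f (p * r) =
      (\<Sum>u\<in>?P. \<Sum>v\<in>?R. Poly_Mapping.single (map_word f u + map_word f v) (?p u * ?r v))"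
    by (simp only: rename_sum rename_single map_word_plus)
  also have "\<dots> = rename f p * rename f r"
    by (simp only: rename_def sum_product mult_single)
  finally show ?thesis .
qed

lemma rename_scalar: "rename f (scalar c) = scalar c"
  by (simp add: scalar_def rename_single map_word_zero)

lemma rename_letter: "rename f (letter g) = letter (f g)"
  by (simp add: letter_def rename_single)

lemma rename_one: "rename f 1 = 1"
  using rename_scalar[of f 1] by (simp add: scalar_def)

lemma rename_power: "rename f (p ^ n) = rename f p ^ n"
  by (induction n) (simp_all add: rename_one rename_mult)

lemma rename_q_serre: "rename f (q_serre q p r) = q_serre q (rename f p) (rename f r)"
  by (simp add: q_serre_def rename_add rename_diff rename_mult rename_power rename_scalar)

lemma rename_closed:
  assumes "f ` G \<subseteq> H" "p \<in> carrier (free_algebra G)"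
  shows "rename f p \<in> carrier (free_algebra H)"
proof -
  have "set (letters w) \<subseteq> H" if w: "w \<in> Poly_Mapping.keys (rename f p)" for w
  proof -
    obtain v where "v \<in> Poly_Mapping.keys p" "w = map_word f v"
      using w keys_sum[of "\<lambda>v. Poly_Mapping.single (map_word f v) (Poly_Mapping.lookup p v)"
          "Poly_Mapping.keys p"]
      by (auto simp: rename_def)
    then show ?thesis
      using assms by (fastforce simp: free_algebra_def word.map_sel)
  qed
  then show ?thesis by (simp add: free_algebra_def)
qed

lemma rename_alg_hom:
  assumes "f ` G \<subseteq> H"
  shows "rename f \<in> alg_hom (free_algebra G) (free_algebra H)"
proof -
  have "rename f \<in> ring_hom (free_algebra G) (free_algebra H)"
    by (rule ring_hom_memI)
      (use rename_closed[OF assms] in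
        \<open>simp_all add: free_algebra_def rename_mult rename_add rename_one\<close>)
  then show ?thesis
    by (simp add: alg_hom_def free_algebra_def rename_mult rename_scalar)
qed

lemma alg_hom_comp:
  assumes "\<theta> \<in> alg_hom A B" "\<psi> \<in> alg_hom B C"
  shows "\<psi> \<circ> \<theta> \<in> alg_hom A C"
  using assms ring_hom_trans[of \<theta> A B \<psi> C] ring_hom_closed[of \<theta> A B]
  by (simp add: alg_hom_def)

lemma presented_algebra_sel:
  "carrier (presented_algebra G Rel) = carrier (free_algebra G Quot relation_ideal G Rel)"
  "monoid.mult (presented_algebra G Rel) = monoid.mult (free_algebra G Quot relation_ideal G Rel)"
  "one (presented_algebra G Rel) = one (free_algebra G Quot relation_ideal G Rel)"
  "zero (presented_algebra G Rel) = zero (free_algebra G Quot relation_ideal G Rel)"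
  "add (presented_algebra G Rel) = add (free_algebra G Quot relation_ideal G Rel)"
  by (simp_all add: presented_algebra_def Let_def ring.defs)

lemma ring_hom_presented_algebra:
  "ring_hom (presented_algebra G Rel) B = ring_hom (free_algebra G Quot relation_ideal G Rel) B"
  "ring_hom A (presented_algebra G Rel) = ring_hom A (free_algebra G Quot relation_ideal G Rel)"
  by (simp_all add: ring_hom_def presented_algebra_sel)

lemma relation_ideal_ideal:
  assumes "Rel \<subseteq> carrier (free_algebra G)"
  shows "ideal (relation_ideal G Rel) (free_algebra G)"
  unfolding relation_ideal_def by (rule ring.genideal_ideal[OF free_algebra_ring assms])

lemma projection_alg_hom:
  assumes "Rel \<subseteq> carrier (free_algebra G)"
  shows "(\<lambda>p. relation_ideal G Rel +>\<^bsub>free_algebra G\<^esub> p)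
    \<in> alg_hom (free_algebra G) (presented_algebra G Rel)"
  using ideal.rcos_ring_hom[OF relation_ideal_ideal[OF assms]]
  by (simp add: alg_hom_def ring_hom_presented_algebra presented_algebra_smult[OF assms])

lemma relation_coset_eq_zero:
  assumes "Rel \<subseteq> carrier (free_algebra G)" "r \<in> Rel"
  shows "relation_ideal G Rel +>\<^bsub>free_algebra G\<^esub> r = \<zero>\<^bsub>presented_algebra G Rel\<^esub>"
proof -
  interpret F: ring "free_algebra G" by (rule free_algebra_ring)
  interpret I: ideal "relation_ideal G Rel" "free_algebra G"
    by (rule relation_ideal_ideal[OF assms(1)])
  have "r \<in> relation_ideal G Rel"
    using F.genideal_self[OF assms(1)] assms(2) by (auto simp: relation_ideal_def)
  then show ?thesis
    using I.a_rcos_const by (simp add: presented_algebra_sel FactRing_def)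
qed

text \<open>
  The universal property of generators and relations. The kernel of \<open>\<theta>\<close> is an ideal, so
  with the relations it contains everything they generate; hence \<open>\<theta>\<close> is constant on each
  coset, and its value there defines the induced map.
\<close>

lemma presented_algebra_universal:
  assumes Rel: "Rel \<subseteq> carrier (free_algebra G)"
    and B: "ring B"
    and \<theta>: "\<theta> \<in> alg_hom (free_algebra G) B"
    and kill: "\<And>r. r \<in> Rel \<Longrightarrow> \<theta> r = \<zero>\<^bsub>B\<^esub>"
  shows "\<exists>\<phi> \<in> alg_hom (presented_algebra G Rel) B. \<forall>p \<in> carrier (free_algebra G).
    \<phi> (relation_ideal G Rel +>\<^bsub>free_algebra G\<^esub> p) = \<theta> p"
proof -
  let ?F = "free_algebra G" and ?I = "relation_ideal G Rel"
  let ?P = "presented_algebra G Rel"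
  define \<phi> where "\<phi> A = the_elem (\<theta> ` A)" for A
  have hom: "\<theta> \<in> ring_hom ?F B" using \<theta> by (simp add: alg_hom_def)
  interpret F: ring ?F by (rule free_algebra_ring)
  interpret I: ideal ?I ?F by (rule relation_ideal_ideal[OF Rel])
  interpret \<theta>: ring_hom_ring ?F B \<theta> by (rule ring_hom_ringI2[OF F.ring_axioms B hom])
  have kernel: "?I \<subseteq> a_kernel ?F B \<theta>"
    unfolding relation_ideal_def
  proof (rule F.genideal_minimal[OF \<theta>.kernel_is_ideal])
    show "Rel \<subseteq> a_kernel ?F B \<theta>" using Rel kill unfolding a_kernel_def' by blast
  qed
  have const: "\<theta> a = \<theta> p" if p: "p \<in> carrier ?F" and a: "a \<in> ?I +>\<^bsub>?F\<^esub> p" for p a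
  proof -
    obtain b where "b \<in> ?I" "a = b \<oplus>\<^bsub>?F\<^esub> p" using a unfolding a_r_coset_def' by blast
    moreover from this have "b \<in> carrier ?F" "\<theta> b = \<zero>\<^bsub>B\<^esub>"
      using kernel I.Icarr unfolding a_kernel_def' by blast+
    ultimately show ?thesis using p \<theta>.hom_add \<theta>.hom_closed by simp
  qed
  have \<phi>: "\<phi> (?I +>\<^bsub>?F\<^esub> p) = \<theta> p" if p: "p \<in> carrier ?F" for p
  proof -
    have "p \<in> ?I +>\<^bsub>?F\<^esub> p" using I.a_rcos_self p by blast
    then have "\<theta> ` (?I +>\<^bsub>?F\<^esub> p) = {\<theta> p}" using const[OF p] by blast
    then show ?thesis by (simp add: \<phi>_def)
  qed
  have repr: "\<exists>p \<in> carrier ?F. A = ?I +>\<^bsub>?F\<^esub> p" if "A \<in> carrier ?P" for A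
    using that by (auto simp: presented_algebra_sel FactRing_def A_RCOSETS_def')
  let ?\<pi> = "\<lambda>p. ?I +>\<^bsub>?F\<^esub> p"
  have \<pi>: "?\<pi> \<in> alg_hom ?F ?P" by (rule projection_alg_hom[OF Rel])
  then have \<pi>_ring: "?\<pi> \<in> ring_hom ?F ?P" by (simp add: alg_hom_def)
  have "\<phi> \<in> ring_hom ?P B"
  proof (rule ring_hom_memI)
    fix A assume "A \<in> carrier ?P"
    then show "\<phi> A \<in> carrier B" using repr \<phi> by fastforce
  next
    fix A C assume "A \<in> carrier ?P" "C \<in> carrier ?P"
    then obtain p r where pr: "p \<in> carrier ?F" "r \<in> carrier ?F" "A = ?\<pi> p" "C = ?\<pi> r"
      using repr by blast
    show "\<phi> (A \<otimes>\<^bsub>?P\<^esub> C) = \<phi> A \<otimes>\<^bsub>B\<^esub> \<phi> C"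
      using pr \<phi> ring_hom_mult[OF \<pi>_ring pr(1,2)] by (metis F.m_closed \<theta>.hom_mult)
    show "\<phi> (A \<oplus>\<^bsub>?P\<^esub> C) = \<phi> A \<oplus>\<^bsub>B\<^esub> \<phi> C"
      using pr \<phi> ring_hom_add[OF \<pi>_ring pr(1,2)] by (metis F.a_closed \<theta>.hom_add)
  next
    show "\<phi> \<one>\<^bsub>?P\<^esub> = \<one>\<^bsub>B\<^esub>"
      using \<phi>[OF F.one_closed] ring_hom_one[OF \<pi>_ring] by simp
  qed
  moreover have "\<phi> (c \<odot>\<^bsub>?P\<^esub> A) = c \<odot>\<^bsub>B\<^esub> \<phi> A" if A: "A \<in> carrier ?P" for c A
  proof -
    obtain p where p: "p \<in> carrier ?F" "A = ?\<pi> p" using repr[OF A] by blast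
    have "c \<odot>\<^bsub>?F\<^esub> p = scalar c \<otimes>\<^bsub>?F\<^esub> p" by (simp add: free_algebra_def)
    then have "c \<odot>\<^bsub>?F\<^esub> p \<in> carrier ?F"
      using p(1) scalar_in_free_algebra by (metis F.m_closed)
    then show ?thesis
      using p \<phi> presented_algebra_smult[OF Rel p(1)] \<theta> by (simp add: alg_hom_def)
  qed
  ultimately have "\<phi> \<in> alg_hom ?P B" by (simp add: alg_hom_def)
  with \<phi> show ?thesis by blast
qed

lemma presented_algebra_rename:
  assumes Rel: "Rel \<subseteq> carrier (free_algebra G)"
    and Rel': "Rel' \<subseteq> carrier (free_algebra H)"
    and f: "f ` G \<subseteq> H"
    and rels: "rename f ` Rel \<subseteq> Rel'"
  shows "\<exists>\<phi> \<in> alg_hom (presented_algebra G Rel) (presented_algebra H Rel').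
    \<forall>g \<in> G. \<phi> (presented_gen G Rel g) = presented_gen H Rel' (f g)"
proof -
  let ?\<theta> = "(\<lambda>p. relation_ideal H Rel' +>\<^bsub>free_algebra H\<^esub> p) \<circ> rename f"
  have "?\<theta> \<in> alg_hom (free_algebra G) (presented_algebra H Rel')"
    by (rule alg_hom_comp[OF rename_alg_hom[OF f] projection_alg_hom[OF Rel']])
  moreover have "?\<theta> r = \<zero>\<^bsub>presented_algebra H Rel'\<^esub>" if "r \<in> Rel" for r
    using relation_coset_eq_zero[OF Rel'] rels that by auto
  ultimately obtain \<phi> where
    "\<phi> \<in> alg_hom (presented_algebra G Rel) (presented_algebra H Rel')"
    "\<forall>p \<in> carrier (free_algebra G).
      \<phi> (relation_ideal G Rel +>\<^bsub>free_algebra G\<^esub> p) = ?\<theta> p"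
    using presented_algebra_universal[OF Rel presented_algebra_ring[OF Rel'], of ?\<theta>]
    by blast
  then show ?thesis
    by (intro bexI[of _ \<phi>]) (auto simp: presented_gen_def rename_letter letter_in_free_algebra)
qed

text \<open>
  The cubic tetrahedron relation with its four consecutive indices written from the
  starting one, so that it can be used at \<open>h = i\<close> and at \<open>h = i + 2\<close>.
\<close>

lemma tet_q_serre:
  "q_serre q (letter (h, h + 1)) (letter (h + 2, h + 3)) \<in> tet_rels q"
proof -
  have "h + 1 - h = 1 \<and> h + 2 - (h + 1) = 1 \<and> h + 3 - (h + 2) = 1" for h :: 4
    by simp
  then show ?thesis unfolding tet_rels_def by blast
qed

theorem proposition9p4:
  fixes q :: "'k::field" and i :: 4
  assumes "q \<noteq> 0" and "q\<^sup>2 \<noteq> 1"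
  shows "\<exists>\<phi> \<in> alg_hom (Aq q) (tet q).
    \<phi> (Aq_x q) = tet_x q i (i + 1) \<and> \<phi> (Aq_y q) = tet_x q (i + 2) (i + 3)"
proof -
  define f where "f g = (case g of LX \<Rightarrow> (i, i + 1) | LY \<Rightarrow> (i + 2, i + 3))" for g
  have f: "f LX = (i, i + 1)" "f LY = (i + 2, i + 3)" by (simp_all add: f_def)
  have "f g \<in> tet_letters" for g
    by (cases g) (simp_all add: f tet_letters_def)
  then have letters: "range f \<subseteq> tet_letters" by blast
  have rels: "rename f ` Aq_rels q \<subseteq> tet_rels q"
  proof -
    \<comment> \<open>Four steps around the square return to the start.\<close>
    have wrap: "i + 2 + 1 = i + 3" "i + 2 + 2 = i" "i + 2 + 3 = i + 1"
      by (simp_all add: add.assoc)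
    have "q_serre q (letter (i + 2, i + 3)) (letter (i, i + 1)) \<in> tet_rels q"
      using tet_q_serre[of q "i + 2"] by (simp only: wrap)
    then show ?thesis
      using tet_q_serre[of q i]
      by (simp add: Aq_rels_def rename_q_serre rename_letter f)
  qed
  obtain \<phi> where "\<phi> \<in> alg_hom (Aq q) (tet q)"
    "\<forall>g. \<phi> (presented_gen UNIV (Aq_rels q) g) = presented_gen tet_letters (tet_rels q) (f g)"
    using presented_algebra_rename[OF Aq_rels_subset tet_rels_subset letters rels]
    unfolding Aq_def tet_def by blast
  then show ?thesis
    by (intro bexI[of _ \<phi>]) (simp_all add: Aq_x_def Aq_y_def tet_x_def f)
qed

end
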